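(* Let $q\in\mathbb{C}$ with $0<|q|<1$, let $b\in\mathbb{C}$, $z\in\mathbb{C}\setminus\{0\}$, and let $x,y\in\mathbb{C}\setminus\{0\}$ with $|q/(xy)|<1$ and $x,y\notin\{q^m:m\ge1\}$. Then $$\sum_{n=0}^{\infty}(x,y)_n(1-bq^n)\Big(\frac{q}{xy}\Big)^n\frac{(-1/z)_{n+1}(-zq)_n}{(q)_{2n+1}}=\frac{(q/x,q/y)_\infty}{(q,q/(xy))_\infty}\sum_{n=-\infty}^{\infty}\frac{(x,y)_n\,q^{\binom{n+1}{2}}\,(qz/(xy))^n}{(q/x,q/y)_n}\left(\frac{1-bq^n}{1-q^{2n+1}}-\frac{q^n-b}{zq(1-q^{2n-1})}\right).$$
   Context: $(a)_n=(a;q)_n=\prod_{j=1}^{n}(1-aq^{j-1})$ for $n\ge0$ (with $(a)_0=1$), $(a)_\infty=\prod_{j\ge0}(1-aq^j)$, and $(a,b)_n=(a)_n(b)_n$, likewise for $n=\infty$. For negative indices, $(a)_{-m}=1/\prod_{j=1}^{m}(1-aq^{-j})$ for $m\ge1$, and $1/(a)_{-m}$ denotes $\prod_{j=1}^{m}(1-aq^{-j})$ (which may be $0$). For $m\in\mathbb{Z}$, $\binom{m}{2}=m(m-1)/2$. *)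

theory Defs
  imports "HOL-Analysis.Analysis"
begin

(* For a = q^m with 1 \<le> m \<le> -n the product in the second branch vanishes and (a;q)_n has a pole.
   Since inverse 0 = 0, the reciprocal 1 / (a;q)_n still equals the product in that case, so it
   follows the usual convention 1 / (a;q)_{-m} = (1 - a/q) ... (1 - a/q^m), see
   inverse_qpoch_neg below. *)
definition qpoch :: "complex \<Rightarrow> complex \<Rightarrow> int \<Rightarrow> complex" where
  "qpoch a q n =
     (if n \<ge> 0 then (\<Prod>j=1..nat n. 1 - a * q ^ (j - 1))
      else 1 / (\<Prod>j=1..nat (- n). 1 - a * q powi (- int j)))"

lemma inverse_qpoch_neg:
  "1 / qpoch a q (- int m) = (\<Prod>j=1..m. 1 - a * q powi (- int j))"
  by (cases "m = 0") (simp_all add: qpoch_def)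

definition qpoch_inf :: "complex \<Rightarrow> complex \<Rightarrow> complex" where
  "qpoch_inf a q = (\<Prod>j. 1 - a * q ^ j)"

(* The division is exact, also for negative m. *)
definition binom2 :: "int \<Rightarrow> int" where
  "binom2 m = m * (m - 1) div 2"

end

theory Submission
  imports Defs
begin

text \<open>
  The identity is Bailey's lemma relative to \<open>1\<close>, in bilateral form, for the pair
  \<open>\<beta>\<^sub>n = \<Sum>\<^sub>r \<alpha>\<^sub>r / ((q)\<^sub>n\<^sub>-\<^sub>r (q)\<^sub>n\<^sub>+\<^sub>r)\<close> with
  \<open>\<beta>\<^sub>n = (1 - b q\<^sup>n) (-1/z)\<^sub>n\<^sub>+\<^sub>1 (-zq)\<^sub>n / (q)\<^sub>2\<^sub>n\<^sub>+\<^sub>1\<close>.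
  Comparing powers of \<open>z\<close>, the pair relation reduces to the finite Jacobi triple product, each coefficient
  of which splits into a contribution of \<open>\<alpha>\<^sub>r\<close> and one of \<open>\<alpha>\<^sub>r\<^sub>+\<^sub>1\<close>.
  Multiplying by \<open>(x)\<^sub>n (y)\<^sub>n (q/xy)\<^sup>n\<close>, summing over \<open>n\<close> and interchanging the sums, the inner sum
  over \<open>n\<close> is a \<open>q\<close>-Gauss sum. The latter is evaluated by a telescoping relation between the parameters
  \<open>c\<close> and \<open>c q\<close>, iterated towards \<open>c q\<^sup>N \<rightarrow> 0\<close>.
\<close>

section \<open>Finite q-shifted factorials, their reciprocals, and index shifts over the
  integers\<close>

definition qp :: "complex \<Rightarrow> complex \<Rightarrow> nat \<Rightarrow> complex" where
  "qp a q n = (\<Prod>j<n. 1 - a * q ^ j)"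

lemma qp_0 [simp]: "qp a q 0 = 1"
  by (simp add: qp_def)

lemma qp_Suc: "qp a q (Suc n) = qp a q n * (1 - a * q ^ n)"
  by (simp add: qp_def)

lemma qp_add: "qp a q (m + n) = qp a q m * qp (a * q ^ m) q n"
  by (induction n) (simp_all add: qp_Suc power_add mult_ac)

lemma qpoch_of_nat: "qpoch a q (int n) = qp a q n"
  unfolding qpoch_def qp_def by (simp add: prod.atLeast1_atMost_eq)

text \<open>
  Since \<open>rq q m\<close> vanishes for \<open>m < 0\<close>, the finite sums of the Bailey pair can be written as sums over
  all integers, where index shifts need no boundary terms.
\<close>

definition rq :: "complex \<Rightarrow> int \<Rightarrow> complex" where
  "rq q m = 1 / qpoch q q m"

lemma rq_of_nat: "rq q (int n) = 1 / qp q q n"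
  by (simp add: rq_def qpoch_of_nat)

lemma rq_neg:
  assumes "q \<noteq> 0" "m < 0"
  shows "rq q m = 0"
proof -
  \<comment> \<open>The factor j = 1 of the product is 1 - q q^(-1) = 0.\<close>
  have "\<exists>j\<in>{1..nat (- m)}. 1 - q * q powi (- int j) = 0"
    using assms by (intro bexI[of _ 1]) (auto simp: power_int_minus)
  then have "(\<Prod>j=1..nat (- m). 1 - q * q powi (- int j)) = 0"
    by (intro prod_zero) auto
  then show ?thesis
    using assms by (simp add: rq_def qpoch_def)
qed

lemma power_neq_1:
  fixes q :: complex
  assumes "norm q < 1" "n > 0"
  shows "q ^ n \<noteq> 1"
  using assms by (metis norm_one norm_power power_less_one_iff norm_ge_zero less_irrefl)

lemma qp_q_nonzero: "norm q < 1 \<Longrightarrow> qp q q n \<noteq> 0"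
  using power_neq_1[of q "Suc _"] by (auto simp: qp_def)

text \<open>For \<open>m > 0\<close> this strips the last factor of (q)_m; at \<open>m = 0\<close>
  the factor \<open>1 - q powi m\<close> vanishes together with \<open>rq q (- 1)\<close>, and below
  that both sides are 0. Hence the recurrence can be used without boundary cases.\<close>

lemma rq_rec:
  assumes "q \<noteq> 0" "norm q < 1"
  shows "rq q (m - 1) = (1 - q powi m) * rq q m"
proof (cases "m \<le> 0")
  case True
  then show ?thesis
    using assms by (cases "m = 0") (simp_all add: rq_neg)
next
  case False
  then obtain k where "m = int (Suc k)"
    by (metis not_gr_zero not_le nat_0_iff nonneg_int_cases order_le_less Suc_pred' of_nat_0 linorder_le_less_linear)
  then show ?thesis
    using qp_q_nonzero[OF assms(2), of k] qp_q_nonzero[OF assms(2), of "Suc k"]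
    by (simp add: rq_of_nat[of q k] rq_of_nat[of q "Suc k", simplified] qp_Suc power_int_def nat_add_distrib)
qed

lemma binom2_Suc: "binom2 (m + 1) = binom2 m + m"
proof -
  have "(m + 1) * m = m * (m - 1) + m * 2"
    by (simp add: algebra_simps)
  then show ?thesis
    by (simp add: binom2_def)
qed

text \<open>Clearing the \<open>div\<close> lets identities between quadratic exponents be checked
  by expanding polynomials.\<close>

lemma two_binom2: "2 * binom2 m = m * (m - 1)"
  unfolding binom2_def by (simp add: even_mult_iff)

lemma has_sum_shift_int:
  fixes f :: "int \<Rightarrow> 'a :: {comm_monoid_add, topological_space}"
  assumes "(f has_sum s) UNIV"
  shows "((\<lambda>k. f (k + c)) has_sum s) UNIV"
  using assms
  by (subst has_sum_reindex_bij_witness[of _ "\<lambda>k. k - c" "\<lambda>k. k + c" UNIV f]) auto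

lemma has_sum_reflect_int:
  fixes f :: "int \<Rightarrow> 'a :: {comm_monoid_add, topological_space}"
  assumes "(f has_sum s) UNIV"
  shows "((\<lambda>k. f (c - k)) has_sum s) UNIV"
  using assms
  by (subst has_sum_reindex_bij_witness[of _ "\<lambda>k. c - k" "\<lambda>k. c - k" UNIV f]) auto

subsection \<open>The finite Jacobi triple product\<close>

text \<open>The finite q-binomial theorem divided by (q)_N: the q-binomial coefficient becomes two
  \<open>rq\<close> factors, which confine the support to 0 <= k <= N. Induction on \<open>N\<close>
  through the q-Pascal rule.\<close>

lemma q_binomial:
  fixes q w :: complex
  assumes "q \<noteq> 0" "norm q < 1" "w \<noteq> 0"
  shows "((\<lambda>k. q powi binom2 k * w powi k * rq q k * rq q (int N - k)) has_sum
           qp (- w) q N / qp q q N) UNIV"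
proof (induction N)
  case 0
  have "rq q k * rq q (- k) = 0" if "k \<noteq> 0" for k
    using that rq_neg[OF assms(1), of k] rq_neg[OF assms(1), of "- k"] by (cases "k < 0") auto
  then show ?case
    using rq_of_nat[of q 0]
    by (intro has_sum_finite_neutralI[of "{0}"]) (auto simp: binom2_def)
next
  case (Suc N)
  define g where "g = (\<lambda>N k. q powi binom2 k * w powi k * rq q k * rq q (int N - k))"
  have nz: "1 - q ^ Suc N \<noteq> 0"
    using power_neq_1[OF assms(2), of "Suc N"] by simp
  \<comment> \<open>q-Pascal rule, from 1 - q^(N+1) = (1 - q^(N+1-k)) + q^(N+1-k) (1 - q^k); each
    bracket lowers the index of one \<open>rq\<close> by \<open>rq_rec\<close>.\<close>
  have step: "(1 - q ^ Suc N) * g (Suc N) k = g N k + w * q ^ N * g N (k - 1)" for k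
  proof -
    define A where "A = q powi binom2 k * w powi k * rq q k * rq q (int N + 1 - k)"
    have 1: "g N k = (1 - q powi (int N + 1 - k)) * A"
      using rq_rec[OF assms(1,2), of "int N + 1 - k"] by (simp add: g_def A_def)
    have e: "binom2 k = binom2 (k - 1) + (k - 1)"
      using binom2_Suc[of "k - 1"] by simp
    have "w * q ^ N * g N (k - 1) =
        w * q ^ N * (q powi binom2 (k - 1) * w powi (k - 1) * ((1 - q powi k) * rq q k) * rq q (int N + 1 - k))"
      unfolding g_def rq_rec[OF assms(1,2), of k] by (simp add: algebra_simps)
    also have "\<dots> = q powi (int N + 1 - k) * (1 - q powi k) * A"
      unfolding A_def e using assms
      by (simp add: power_int_add power_int_diff field_simps)
    finally have 2: "w * q ^ N * g N (k - 1) = q powi (int N + 1 - k) * (1 - q powi k) * A" .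
    have 3: "q powi (int N + 1 - k) * q powi k = q ^ Suc N"
      using assms by (simp add: power_int_add power_int_diff)
    have "g (Suc N) k = A"
      by (simp add: g_def A_def algebra_simps)
    then show ?thesis
      unfolding 1 2 3[symmetric] by (simp add: algebra_simps)
  qed
  have IH: "(g N has_sum qp (- w) q N / qp q q N) UNIV"
    using Suc by (simp add: g_def)
  \<comment> \<open>Shifting k preserves the total, so the two pieces add up to 1 + w q^N times the
    inductive value.\<close>
  have "((\<lambda>k. g N k + w * q ^ N * g N (k + (-1))) has_sum
      (qp (- w) q N / qp q q N + w * q ^ N * (qp (- w) q N / qp q q N))) UNIV"
    by (intro has_sum_add has_sum_cmult_right has_sum_shift_int IH)
  then have "((\<lambda>k. (1 - q ^ Suc N) * g (Suc N) k) has_sum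
      (qp (- w) q N / qp q q N + w * q ^ N * (qp (- w) q N / qp q q N))) UNIV"
    unfolding step by simp
  then have "(g (Suc N) has_sum
      (qp (- w) q N / qp q q N + w * q ^ N * (qp (- w) q N / qp q q N)) / (1 - q ^ Suc N)) UNIV"
    using has_sum_cmult_right_iff[OF nz] by blast
  also have "(qp (- w) q N / qp q q N + w * q ^ N * (qp (- w) q N / qp q q N)) / (1 - q ^ Suc N) =
      qp (- w) q (Suc N) / qp q q (Suc N)"
    using nz qp_q_nonzero[OF assms(2), of N] by (simp add: qp_Suc divide_simps) (simp add: algebra_simps)
  finally show ?case
    by (simp add: g_def)
qed

text \<open>Factor by factor, 1 + q^j/(z q^n) = (1 + z q^(n-j)) / (z q^(n-j)); the denominators over
  j < n multiply to the prefactor on the left.\<close>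

lemma qp_reverse:
  assumes "q \<noteq> 0" "z \<noteq> 0"
  shows "z ^ n * q powi binom2 (int n + 1) * qp (- 1 / (z * q ^ n)) q n = qp (- z * q) q n"
proof (induction n)
  case 0
  then show ?case by (simp add: binom2_def)
next
  case (Suc n)
  have "qp (- 1 / (z * q ^ Suc n)) q (Suc n) =
      (1 + 1 / (z * q ^ Suc n)) * qp (- 1 / (z * q ^ n)) q n"
    using assms qp_add[of "- 1 / (z * q ^ Suc n)" q 1 n] by (simp add: qp_def field_simps)
  then have "z ^ Suc n * q powi binom2 (int (Suc n) + 1) * qp (- 1 / (z * q ^ Suc n)) q (Suc n) =
     (z ^ n * q powi binom2 (int n + 1) * qp (- 1 / (z * q ^ n)) q n) *
      (z * q ^ Suc n * (1 + 1 / (z * q ^ Suc n)))"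
    using assms binom2_Suc[of "int n + 1"]
    by (simp add: power_int_add add_ac)
  also have "\<dots> = qp (- z * q) q (Suc n)"
    unfolding Suc using assms by (simp add: qp_Suc field_simps)
  finally show ?case .
qed

text \<open>The q-binomial theorem with N = 2n+1 and w = 1/(z q^n), recentred by k = n - r. The
  first n factors of (-w)_(2n+1) become (-zq)_n by reversal; the other n+1 are (-1/z)_(n+1).\<close>

lemma finite_triple_product:
  assumes "q \<noteq> 0" "norm q < 1" "z \<noteq> 0"
  shows "((\<lambda>r. q powi binom2 (r + 1) * z powi r * rq q (int n - r) * rq q (int n + r + 1)) has_sum
           qp (- 1 / z) q (n + 1) * qp (- z * q) q n / qp q q (2 * n + 1)) UNIV"
proof -
  define w where "w = 1 / (z * q ^ n)"
  \<comment> \<open>This constant serves twice: it normalises the coefficients in \<open>2\<close>,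
    and it is the prefactor of \<open>qp_reverse\<close> needed in \<open>3\<close>.\<close>
  define C where "C = z ^ n * q powi binom2 (int n + 1)"
  have w: "w \<noteq> 0" and wp: "w = z powi (- 1) * q powi (- int n)"
    using assms by (simp_all add: w_def power_int_minus field_simps)
  have 1: "((\<lambda>r. C * (q powi binom2 (int n - r) * w powi (int n - r) * rq q (int n - r) *
          rq q (int (2 * n + 1) - (int n - r)))) has_sum
          C * (qp (- w) q (2 * n + 1) / qp q q (2 * n + 1))) UNIV"
    using has_sum_cmult_right[OF has_sum_reflect_int[OF q_binomial[OF assms(1,2) w]]] .
  have 2: "C * (q powi binom2 (int n - r) * w powi (int n - r) * rq q (int n - r) *
          rq q (int (2 * n + 1) - (int n - r))) =
      q powi binom2 (r + 1) * z powi r * rq q (int n - r) * rq q (int n + r + 1)" for r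
  proof -
    have e: "binom2 (r + 1) = binom2 (int n + 1) + binom2 (int n - r) - int n * (int n - r)"
      using two_binom2[of "r + 1"] two_binom2[of "int n + 1"] two_binom2[of "int n - r"]
      by (simp add: algebra_simps)
    have "w powi (int n - r) = z powi (- 1 * (int n - r)) * q powi (- int n * (int n - r))"
      unfolding wp power_int_mult_distrib power_int_mult ..
    then have wpow: "w powi (int n - r) = z powi (r - int n) * q powi (- (int n * (int n - r)))"
      by simp
    have "C * (q powi binom2 (int n - r) * w powi (int n - r)) = q powi binom2 (r + 1) * z powi r"
      unfolding wpow e C_def using assms
      by (simp add: power_int_add power_int_diff power_int_minus field_simps)
    moreover have "int (2 * n + 1) - (int n - r) = int n + r + 1" by simp
    ultimately show ?thesis
      by (metis (no_types, lifting) mult.assoc)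
  qed
  have 3: "C * qp (- w) q (2 * n + 1) = qp (- 1 / z) q (n + 1) * qp (- z * q) q n"
  proof -
    have "qp (- w) q (n + (n + 1)) = qp (- 1 / (z * q ^ n)) q n * qp (- 1 / z) q (n + 1)"
      unfolding qp_add[of _ _ n] using assms by (simp add: w_def)
    moreover have "2 * n + 1 = n + (n + 1)" by simp
    ultimately show ?thesis
      using qp_reverse[OF assms(1,3), of n] by (simp only: C_def mult_ac)
  qed
  show ?thesis
    using 1 unfolding 2 times_divide_eq_right 3 .
qed

subsection \<open>Infinite products and bounds\<close>

lemma qp_tendsto_qpoch_inf:
  assumes "norm q < 1"
  shows "qp a q \<longlonglongrightarrow> qpoch_inf a q"
    and "convergent_prod (\<lambda>j. 1 - a * q ^ j)"
proof -
  have "summable (\<lambda>j. norm (1 - a * q ^ j - 1))"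
    using assms by (simp add: norm_mult norm_power summable_mult)
  then show *: "convergent_prod (\<lambda>j. 1 - a * q ^ j)"
    by (intro abs_convergent_prod_imp_convergent_prod summable_imp_abs_convergent_prod)
  have "(\<lambda>n. qp a q (Suc n)) \<longlonglongrightarrow> qpoch_inf a q"
    using convergent_prod_LIMSEQ[OF *]
    by (simp add: qp_def qpoch_inf_def lessThan_Suc_atMost)
  then show "qp a q \<longlonglongrightarrow> qpoch_inf a q"
    by (simp add: filterlim_sequentially_Suc)
qed

lemma qpoch_inf_nonzero:
  assumes "norm q < 1" "\<And>j. a * q ^ j \<noteq> 1"
  shows "qpoch_inf a q \<noteq> 0"
  unfolding qpoch_inf_def using assms(2)
  by (intro prodinf_nonzero qp_tendsto_qpoch_inf(2)[OF assms(1)]) (metis right_minus_eq)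

lemma qpoch_inf_split:
  assumes "norm q < 1"
  shows "qpoch_inf a q = qp a q n * qpoch_inf (a * q ^ n) q"
proof -
  have "(\<lambda>m. qp a q n * qp (a * q ^ n) q m) \<longlonglongrightarrow> qp a q n * qpoch_inf (a * q ^ n) q"
    by (intro tendsto_intros qp_tendsto_qpoch_inf assms)
  moreover have "(\<lambda>m. qp a q (m + n)) \<longlonglongrightarrow> qpoch_inf a q"
    by (intro LIMSEQ_ignore_initial_segment qp_tendsto_qpoch_inf assms)
  ultimately show ?thesis
    unfolding add.commute[of _ n] qp_add[of a q n] by (rule LIMSEQ_unique[symmetric])
qed

lemma qp_bounded:
  assumes "norm q < 1"
  obtains M where "M > 0" "\<And>n. norm (qp a q n) \<le> M"
  using convergent_imp_Bseq[OF convergentI[OF qp_tendsto_qpoch_inf(1)[OF assms, of a]]]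
  unfolding Bseq_def by blast

text \<open>The infinite product is nonzero, so the reciprocals converge and are therefore
  bounded.\<close>

lemma inverse_qp_bounded:
  assumes "norm q < 1" "\<And>j. a * q ^ j \<noteq> 1"
  obtains M where "M > 0" "\<And>n. norm (1 / qp a q n) \<le> M"
proof -
  have "(\<lambda>n. 1 / qp a q n) \<longlonglongrightarrow> 1 / qpoch_inf a q"
    by (intro tendsto_intros qp_tendsto_qpoch_inf assms qpoch_inf_nonzero)
  from convergent_imp_Bseq[OF convergentI[OF this]] show ?thesis
    unfolding Bseq_def using that by blast
qed

lemma qp_nonzero: "(\<And>j. a * q ^ j \<noteq> 1) \<Longrightarrow> qp a q n \<noteq> 0"
  by (auto simp: qp_def)

lemma norm_q_power_mult_neq_1:
  fixes q u :: complex
  assumes "norm q < 1" "norm u < 1"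
  shows "u * q ^ j \<noteq> 1"
proof
  assume "u * q ^ j = 1"
  then have "norm u * norm q ^ j = 1"
    by (metis norm_mult norm_power norm_one)
  moreover have "norm u * norm q ^ j \<le> norm u"
    using assms by (simp add: mult_left_le power_le_one)
  ultimately show False using assms by simp
qed

subsection \<open>The \<open>q\<close>-Gauss sum\<close>

text \<open>Summand of the basic hypergeometric series 2phi1(a, b; c; q, c/(ab)), at the argument of
  Heine's q-Gauss evaluation.\<close>

definition gauss_term :: "complex \<Rightarrow> complex \<Rightarrow> complex \<Rightarrow> complex \<Rightarrow> nat \<Rightarrow> complex" where
  "gauss_term q a b c k = qp a q k * qp b q k / (qp q q k * qp c q k) * (c / (a * b)) ^ k"

text \<open>A single \<open>M\<close> for all \<open>N\<close> is what dominated convergence along c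
  q^N requires. Uniformity comes from 1/(c q^N)_k = (c)_N / (c)_(N+k).\<close>

lemma gauss_term_bound:
  assumes "norm q < 1" "\<And>j. c * q ^ j \<noteq> 1"
  obtains M where "M > 0" "\<And>N k. norm (gauss_term q a b (c * q ^ N) k) \<le> M * norm (c * q ^ N / (a * b)) ^ k"
proof -
  obtain A where A: "A > 0" "\<And>n. norm (qp a q n) \<le> A" by (rule qp_bounded[OF assms(1)]) blast
  obtain B where B: "B > 0" "\<And>n. norm (qp b q n) \<le> B" by (rule qp_bounded[OF assms(1)]) blast
  obtain C where C: "C > 0" "\<And>n. norm (qp c q n) \<le> C" by (rule qp_bounded[OF assms(1)]) blast
  obtain D where D: "D > 0" "\<And>n. norm (1 / qp c q n) \<le> D" by (rule inverse_qp_bounded[OF assms]) blast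
  have "q * q ^ j \<noteq> 1" for j
    using norm_q_power_mult_neq_1[OF assms(1,1)] .
  then obtain E where E: "E > 0" "\<And>n. norm (1 / qp q q n) \<le> E"
    by (rule inverse_qp_bounded[OF assms(1)]) blast
  show ?thesis
  proof (rule that[of "A * B * E * (C * D)"])
    show "A * B * E * (C * D) > 0" using A B C D E by simp
    fix N k
    have "1 / qp (c * q ^ N) q k = qp c q N * (1 / qp c q (N + k))"
      using qp_nonzero[OF assms(2), of N] by (simp add: qp_add)
    then have "gauss_term q a b (c * q ^ N) k =
       qp a q k * qp b q k * (1 / qp q q k) * (qp c q N * (1 / qp c q (N + k))) * (c * q ^ N / (a * b)) ^ k"
      by (simp add: gauss_term_def divide_inverse mult.assoc[symmetric])
    then have "norm (gauss_term q a b (c * q ^ N) k) =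
       norm (qp a q k) * norm (qp b q k) * norm (1 / qp q q k) *
       (norm (qp c q N) * norm (1 / qp c q (N + k))) * norm (c * q ^ N / (a * b)) ^ k"
      by (simp only: norm_mult norm_power)
    also have "\<dots> \<le> A * B * E * (C * D) * norm (c * q ^ N / (a * b)) ^ k"
      using A B C D E by (intro mult_mono mult_nonneg_nonneg) (auto intro: less_imp_le)
    finally show "norm (gauss_term q a b (c * q ^ N) k) \<le> A * B * E * (C * D) * norm (c * q ^ N / (a * b)) ^ k" .
  qed
qed

lemma gauss_term_summable:
  assumes "norm q < 1" "\<And>j. c * q ^ j \<noteq> 1" "norm (c / (a * b)) < 1"
  shows "summable (\<lambda>k. norm (gauss_term q a b c k))"
proof -
  obtain M where M: "M > 0" "\<And>N k. norm (gauss_term q a b (c * q ^ N) k) \<le> M * norm (c * q ^ N / (a * b)) ^ k"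
    using gauss_term_bound[of q c a b, OF assms(1,2)] by blast
  have "norm (norm (gauss_term q a b c k)) \<le> M * norm (c / (a * b)) ^ k" for k
    using M(2)[of 0 k] by simp
  moreover have "summable (\<lambda>k. M * norm (c / (a * b)) ^ k)"
    using assms(3) by (intro summable_mult summable_geometric) simp
  ultimately show ?thesis
    by (rule summable_comparison_test'[rotated])
qed

text \<open>
  The certificate \<open>G\<close> comes from Gosper's algorithm, applied to the contiguous relation
  \<open>c \<mapsto> c q\<close> with \<open>a\<close> and \<open>b\<close> fixed.
\<close>

lemma gauss_telescoping:
  assumes "norm q < 1" "\<And>j. c * q ^ j \<noteq> 1" "a \<noteq> 0" "b \<noteq> 0"
  defines "G \<equiv> \<lambda>k. - ((1 - q ^ k) * gauss_term q a b c k)"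
  shows "(1 - c / (a * b)) * gauss_term q a b c k -
           (1 - c / a) * (1 - c / b) / (1 - c) * gauss_term q a b (c * q) k = G (Suc k) - G k"
proof -
  define t where "t = gauss_term q a b c k"
  have c1: "1 - c \<noteq> 0" and ck: "1 - c * q ^ k \<noteq> 0"
    using assms(2)[of 0] assms(2)[of k] by simp_all
  have qk: "1 - q * q ^ k \<noteq> 0"
    using power_neq_1[OF assms(1), of "Suc k"] by simp
  have nz: "qp c q k \<noteq> 0" "qp (c * q) q k \<noteq> 0" "qp q q k \<noteq> 0"
    using qp_nonzero[OF assms(2)] qp_nonzero[of "c * q" q] assms(2)[of "Suc _"] qp_q_nonzero[OF assms(1)]
    by (auto simp: mult.assoc)
  \<comment> \<open>Both sides equal (c)_(k+1); this makes the term at \<open>c * q\<close> a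
    rational multiple of \<open>t\<close>.\<close>
  have "(1 - c) * qp (c * q) q k = qp c q k * (1 - c * q ^ k)"
    using qp_add[of c q 1 k] qp_Suc[of c q k] by (simp add: qp_def)
  then have e: "qp c q k = (1 - c) * qp (c * q) q k / (1 - c * q ^ k)"
    using ck by (simp add: field_simps)
  then have 1: "gauss_term q a b (c * q) k = t * q ^ k * (1 - c) / (1 - c * q ^ k)"
    unfolding t_def gauss_term_def e using c1 ck nz(2,3)
    by (simp add: divide_simps power_mult_distrib)
  have "gauss_term q a b c (Suc k) =
     t * ((1 - a * q ^ k) * (1 - b * q ^ k) * (c / (a * b))) / ((1 - q * q ^ k) * (1 - c * q ^ k))"
    by (simp add: t_def gauss_term_def qp_Suc mult_ac)
  \<comment> \<open>The factor 1 - q^(k+1) of the certificate cancels the new factor of (q)_(k+1).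
    What remains is a rational identity in q^k, a, b, c.\<close>
  then have 2: "G (Suc k) = - (t * ((1 - a * q ^ k) * (1 - b * q ^ k) * (c / (a * b))) / (1 - c * q ^ k))"
    using qk by (simp add: G_def mult_ac)
  show ?thesis
    unfolding 1 2 t_def[symmetric] using c1 ck assms(3,4)
    unfolding G_def t_def[symmetric]
    by (simp add: divide_simps) (simp add: algebra_simps)
qed

text \<open>Summing the telescoping relation leaves no boundary terms: \<open>G 0 = 0\<close>
  because 1 - q^0 = 0, and \<open>G\<close> tends to 0 with the terms of a convergent
  series.\<close>

lemma gauss_contiguous:
  assumes "norm q < 1" "\<And>j. c * q ^ j \<noteq> 1" "a \<noteq> 0" "b \<noteq> 0" "norm (c / (a * b)) < 1"
  shows "(1 - c) * (1 - c / (a * b)) * suminf (gauss_term q a b c) =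
           (1 - c / a) * (1 - c / b) * suminf (gauss_term q a b (c * q))"
proof -
  define G where "G = (\<lambda>k. - ((1 - q ^ k) * gauss_term q a b c k))"
  have s1: "summable (gauss_term q a b c)"
    using gauss_term_summable[OF assms(1,2,5)] by (rule summable_norm_cancel)
  have "norm (c * q / (a * b)) \<le> norm (c / (a * b))"
    using assms(1) by (simp add: norm_mult norm_divide divide_right_mono mult_left_le)
  then have s2: "summable (gauss_term q a b (c * q))"
    using assms(2)[of "Suc _"] assms(1,5)
    by (intro summable_norm_cancel[OF gauss_term_summable]) (auto simp: mult.assoc)
  have "G \<longlonglongrightarrow> - ((1 - 0) * 0)"
    unfolding G_def using LIMSEQ_power_zero[OF assms(1)]
    by (intro tendsto_minus tendsto_mult tendsto_diff tendsto_const summable_LIMSEQ_zero[OF s1])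
  then have "(\<lambda>k. G (Suc k) - G k) sums 0"
    using telescope_sums[of G 0] by (simp add: G_def)
  moreover have "(\<lambda>k. (1 - c / (a * b)) * gauss_term q a b c k -
           (1 - c / a) * (1 - c / b) / (1 - c) * gauss_term q a b (c * q) k) sums
      ((1 - c / (a * b)) * suminf (gauss_term q a b c) -
           (1 - c / a) * (1 - c / b) / (1 - c) * suminf (gauss_term q a b (c * q)))"
    by (intro sums_diff sums_mult summable_sums s1 s2)
  ultimately have "(1 - c / (a * b)) * suminf (gauss_term q a b c) -
           (1 - c / a) * (1 - c / b) / (1 - c) * suminf (gauss_term q a b (c * q)) = 0"
    unfolding gauss_telescoping[OF assms(1-4)] G_def using sums_unique2 by blast
  then show ?thesis
    using assms(2)[of 0] by (simp add: field_simps)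
qed

text \<open>Applying contiguity N times moves c to c q^N at the cost of finite products. As N grows
  these become infinite products, and the remaining series tends to its k = 0 term, which is
  1.\<close>

lemma q_gauss:
  assumes "norm q < 1" "\<And>j. c * q ^ j \<noteq> 1" "a \<noteq> 0" "b \<noteq> 0" "norm (c / (a * b)) < 1"
  shows "gauss_term q a b c sums
    (qpoch_inf (c / a) q * qpoch_inf (c / b) q / (qpoch_inf c q * qpoch_inf (c / (a * b)) q))"
proof -
  define S where "S = (\<lambda>N. suminf (gauss_term q a b (c * q ^ N)))"
  define u where "u = norm (c / (a * b))"
  have le: "norm (c * q ^ N / (a * b)) \<le> u" for N
    using assms(1) by (simp add: u_def norm_mult norm_divide norm_power divide_right_mono mult_left_le power_le_one)
  have iter: "qp c q N * qp (c / (a * b)) q N * S 0 = qp (c / a) q N * qp (c / b) q N * S N" for N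
  proof (induction N)
    case (Suc N)
    have "c * q ^ N * q ^ j \<noteq> 1" for j
      using assms(2)[of "N + j"] by (simp add: power_add mult.assoc)
    moreover have "norm (c * q ^ N / (a * b)) < 1"
      using le[of N] assms(5) by (simp add: u_def)
    ultimately have e: "(1 - c * q ^ N) * (1 - c * q ^ N / (a * b)) * S N =
        (1 - c * q ^ N / a) * (1 - c * q ^ N / b) * S (Suc N)"
      using gauss_contiguous[of q "c * q ^ N" a b, OF assms(1) _ assms(3,4)] by (simp add: S_def mult_ac)
    have "qp c q (Suc N) * qp (c / (a * b)) q (Suc N) * S 0 =
        (qp c q N * qp (c / (a * b)) q N * S 0) * ((1 - c * q ^ N) * (1 - c * q ^ N / (a * b)))"
      by (simp add: qp_Suc)
    also have "\<dots> = qp (c / a) q N * qp (c / b) q N *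
        ((1 - c * q ^ N) * (1 - c * q ^ N / (a * b)) * S N)"
      unfolding Suc by (simp only: mult_ac)
    also have "\<dots> = qp (c / a) q (Suc N) * qp (c / b) q (Suc N) * S (Suc N)"
      unfolding e by (simp add: qp_Suc)
    finally show ?case .
  qed simp
  obtain M where M: "M > 0" "\<And>N k. norm (gauss_term q a b (c * q ^ N) k) \<le> M * norm (c * q ^ N / (a * b)) ^ k"
    using gauss_term_bound[of q c a b, OF assms(1,2)] by blast
  \<comment> \<open>A majorant free of \<open>N\<close>, for Tannery's theorem.\<close>
  have bound: "norm (gauss_term q a b (c * q ^ N) k) \<le> M * u ^ k" for N k
    using M(2)[of N k] M(1) le[of N] by (meson mult_left_mono order_trans power_mono norm_ge_zero less_imp_le)
  have lim: "(\<lambda>N. gauss_term q a b (c * q ^ N) k) \<longlonglongrightarrow> (if k = 0 then 1 else 0)" for k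
  proof (cases "k = 0")
    case True
    then show ?thesis by (simp add: gauss_term_def)
  next
    case False
    have "(\<lambda>N. q ^ N) \<longlonglongrightarrow> 0"
      using assms(1) by (rule LIMSEQ_power_zero)
    then have "(\<lambda>N. M * norm (c * q ^ N / (a * b)) ^ k) \<longlonglongrightarrow> M * norm (c * 0 / (a * b)) ^ k"
      unfolding divide_inverse
      by (intro tendsto_mult tendsto_power[of _ _ _ k] tendsto_norm tendsto_const)
    then have "(\<lambda>N. M * norm (c * q ^ N / (a * b)) ^ k) \<longlonglongrightarrow> 0"
      using False by (simp add: zero_power)
    then show ?thesis
      using False M(2) by (auto intro: Lim_null_comparison[rotated])
  qed
  have "summable (\<lambda>k. M * u ^ k)"
    using assms(5) by (intro summable_mult summable_geometric) (simp add: u_def)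
  moreover have "\<forall>\<^sub>F (k, N) in sequentially \<times>\<^sub>F sequentially.
      norm (gauss_term q a b (c * q ^ N) k) \<le> M * u ^ k"
    using bound by (intro always_eventually) auto
  ultimately have "S \<longlonglongrightarrow> (\<Sum>k. if k = 0 then 1 else 0)"
    unfolding S_def
    by (intro tannerys_theorem[where a = "\<lambda>k N. gauss_term q a b (c * q ^ N) k" and
          M = "\<lambda>k. M * u ^ k", THEN conjunct2, THEN conjunct2, OF lim]) auto
  also have "(\<Sum>k::nat. if k = 0 then 1 else 0::complex) = 1"
    using suminf_finite[of "{0::nat}" "\<lambda>k. if k = 0 then 1 else 0::complex"] by simp
  finally have "S \<longlonglongrightarrow> 1" .
  then have "(\<lambda>N. qp (c / a) q N * qp (c / b) q N * S N) \<longlonglongrightarrow> qpoch_inf (c / a) q * qpoch_inf (c / b) q * 1"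
    by (intro tendsto_intros qp_tendsto_qpoch_inf assms(1))
  moreover have "(\<lambda>N. qp c q N * qp (c / (a * b)) q N * S 0) \<longlonglongrightarrow> qpoch_inf c q * qpoch_inf (c / (a * b)) q * S 0"
    by (intro tendsto_intros qp_tendsto_qpoch_inf assms(1))
  ultimately have "qpoch_inf c q * qpoch_inf (c / (a * b)) q * S 0 = qpoch_inf (c / a) q * qpoch_inf (c / b) q"
    unfolding iter using LIMSEQ_unique by fastforce
  moreover have "qpoch_inf c q \<noteq> 0" "qpoch_inf (c / (a * b)) q \<noteq> 0"
    using qpoch_inf_nonzero[OF assms(1,2)]
      qpoch_inf_nonzero[OF assms(1) norm_q_power_mult_neq_1[OF assms(1,5)]] by blast+
  ultimately have "S 0 = qpoch_inf (c / a) q * qpoch_inf (c / b) q / (qpoch_inf c q * qpoch_inf (c / (a * b)) q)"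
    by (simp add: field_simps)
  moreover have "gauss_term q a b c sums S 0"
    using summable_sums[OF summable_norm_cancel[OF gauss_term_summable[OF assms(1,2,5)]]]
    by (simp add: S_def)
  ultimately show ?thesis by simp
qed

subsection \<open>The inner sum of Bailey's lemma\<close>

text \<open>The factor \<open>rq q (int n - int m)\<close> kills n < m. With n = k + m the rest is a
  q-Gauss series with parameters x q^m, y q^m, q^(2m+1), whose argument q/(xy) does not depend on
  m.\<close>

lemma sum_gauss_weight_nonneg:
  assumes "q \<noteq> 0" "norm q < 1" "x \<noteq> 0" "y \<noteq> 0" "norm (q / (x * y)) < 1"
    and "\<And>j. q / x * q ^ j \<noteq> 1" "\<And>j. q / y * q ^ j \<noteq> 1"
  shows "((\<lambda>n. qp x q n * qp y q n * (q / (x * y)) ^ n * rq q (int n - int m) * rq q (int n + int m)) has_sum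
    qpoch_inf (q / x) q * qpoch_inf (q / y) q / (qpoch_inf q q * qpoch_inf (q / (x * y)) q) *
    (qp x q m * qp y q m * (q / (x * y)) ^ m / (qp (q / x) q m * qp (q / y) q m))) UNIV"
    (is "(?f has_sum ?S) UNIV")
proof -
  define a b c where "a = x * q ^ m" and "b = y * q ^ m" and "c = q * q ^ (2 * m)"
  define D where "D = qp x q m * qp y q m * (q / (x * y)) ^ m / qp q q (2 * m)"
  have ab: "a \<noteq> 0" "b \<noteq> 0"
    using assms by (simp_all add: a_def b_def)
  have c: "c = q * (q ^ m * q ^ m)"
    by (simp add: c_def power_add mult_2)
  have cab: "c / (a * b) = q / (x * y)" and ca: "c / a = q / x * q ^ m" and cb: "c / b = q / y * q ^ m"
    using assms by (simp_all add: a_def b_def c field_simps)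
  have "norm c \<le> norm q"
    using assms(2) by (simp add: c_def norm_mult norm_power mult_left_le power_le_one)
  then have "norm c < 1"
    using assms(2) by simp
  then have cj: "c * q ^ j \<noteq> 1" for j
    by (rule norm_q_power_mult_neq_1[OF assms(2)])
  have zero: "?f i = 0" if "i < m" for i
    using that rq_neg[OF assms(1), of "int i - int m"] by simp
  have shift: "?f (k + m) = D * gauss_term q a b c k" for k
  proof -
    have "rq q (int (k + m) - int m) = 1 / qp q q k"
      using rq_of_nat[of q k] by simp
    moreover have "rq q (int (k + m) + int m) = 1 / (qp q q (2 * m) * qp c q k)"
      using rq_of_nat[of q "2 * m + k"] qp_add[of q q "2 * m" k]
      by (simp add: c_def algebra_simps)
    moreover have "qp x q (k + m) = qp x q m * qp a q k" "qp y q (k + m) = qp y q m * qp b q k"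
      unfolding add.commute[of k] by (simp_all add: qp_add a_def b_def)
    ultimately show ?thesis
      by (simp add: D_def gauss_term_def cab power_add mult_ac)
  qed
  have norm: "summable (\<lambda>n. norm (?f n))"
  proof -
    have "summable (\<lambda>k. norm (D * gauss_term q a b c k))"
      using gauss_term_summable[OF assms(2) cj, of a b] assms(5)
      unfolding cab norm_mult by (intro summable_mult) auto
    then have "summable (\<lambda>k. norm (?f (k + m)))"
      unfolding shift .
    then show ?thesis
      by (rule summable_iff_shift[THEN iffD1])
  qed
  have "(\<lambda>k. ?f (k + m)) sums (D * (qpoch_inf (c / a) q * qpoch_inf (c / b) q / (qpoch_inf c q * qpoch_inf (c / (a * b)) q)))"
    unfolding shift using assms(5) by (intro sums_mult q_gauss assms(2) cj ab) (simp add: cab)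
  then have "?f sums (D * (qpoch_inf (c / a) q * qpoch_inf (c / b) q / (qpoch_inf c q * qpoch_inf (c / (a * b)) q)))"
    by (subst (asm) sums_zero_iff_shift[OF zero])
  also have "D * (qpoch_inf (c / a) q * qpoch_inf (c / b) q / (qpoch_inf c q * qpoch_inf (c / (a * b)) q)) = ?S"
    \<comment> \<open>Splitting (q)_inf at 2m supplies the (q)_(2m) in the denominator of
      \<open>D\<close>; the factors (q/x)_m and (q/y)_m cancel.\<close>
    unfolding qpoch_inf_split[OF assms(2), of "q / x" m] qpoch_inf_split[OF assms(2), of "q / y" m]
      qpoch_inf_split[OF assms(2), of q "2 * m"] cab ca cb c_def[symmetric] D_def
    using qp_nonzero[OF assms(6), of m] qp_nonzero[OF assms(7), of m]
    by simp
  finally show ?thesis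
    using norm_summable_imp_has_sum[OF norm] by blast
qed

text \<open>Pulling -q^(-k)/x out of 1 - q^(-k)/x and -x q^(-k-1) out of 1 - x q^(-k-1) turns each
  quotient into one with nonnegative exponents, times q/x^2.\<close>

lemma qpoch_ratio_reflect:
  assumes "q \<noteq> 0" "x \<noteq> 0" "\<And>j. q / x * q ^ j \<noteq> 1"
  shows "qpoch x q (- int m) / qpoch (q / x) q (- int m) = (q / x\<^sup>2) ^ m * (qp x q m / qp (q / x) q m)"
proof -
  have factor: "(1 - q / x * q powi (- int (Suc k))) / (1 - x * q powi (- int (Suc k))) =
      q / x\<^sup>2 * ((1 - x * q ^ k) / (1 - q / x * q ^ k))" for k
  proof -
    have "x \<noteq> q * q ^ k"
      using assms(2) assms(3)[of k] by auto
    then have "q * q ^ k - x \<noteq> 0" "x - q * q ^ k \<noteq> 0"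
      by auto
    moreover have pw: "q powi (- int (Suc k)) = 1 / (q * q ^ k)"
      using power_int_minus[of q "int (Suc k)"] by (simp add: divide_inverse del: of_nat_Suc)
    ultimately show ?thesis
      unfolding pw using assms(1,2)
      by (simp add: divide_simps power2_eq_square) (simp add: algebra_simps)
  qed
  \<comment> \<open>Taking reciprocals stays correct at a pole of (q/x)_(-m), where
    \<open>qpoch\<close> has the value 0: the quotient is then 0, matching the zero of
    (x)_m.\<close>
  have "qpoch x q (- int m) / qpoch (q / x) q (- int m) =
      (1 / qpoch (q / x) q (- int m)) / (1 / qpoch x q (- int m))"
    by simp
  also have "\<dots> = (\<Prod>k<m. (1 - q / x * q powi (- int (Suc k))) / (1 - x * q powi (- int (Suc k))))"
    unfolding inverse_qpoch_neg prod.atLeast1_atMost_eq prod_dividef One_nat_def ..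
  also have "\<dots> = (q / x\<^sup>2) ^ m * (qp x q m / qp (q / x) q m)"
    unfolding factor by (simp add: qp_def prod.distrib prod_dividef power_divide)
  finally show ?thesis .
qed

text \<open>The left side is even in \<open>r\<close>. By reflection so is the right side, since
  (q/x^2)^m (q/y^2)^m (q/(xy))^(-m) = (q/(xy))^m; thus |r| suffices.\<close>

lemma sum_gauss_weight:
  assumes "q \<noteq> 0" "norm q < 1" "x \<noteq> 0" "y \<noteq> 0" "norm (q / (x * y)) < 1"
    and "\<And>j. q / x * q ^ j \<noteq> 1" "\<And>j. q / y * q ^ j \<noteq> 1"
  shows "((\<lambda>n. qp x q n * qp y q n * (q / (x * y)) ^ n * rq q (int n - r) * rq q (int n + r)) has_sum
    qpoch_inf (q / x) q * qpoch_inf (q / y) q / (qpoch_inf q q * qpoch_inf (q / (x * y)) q) *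
    (qpoch x q r * qpoch y q r * (q / (x * y)) powi r / (qpoch (q / x) q r * qpoch (q / y) q r))) UNIV"
proof (cases r rule: int_cases2)
  case (nonneg m)
  then show ?thesis
    using sum_gauss_weight_nonneg[OF assms, of m] by (simp add: qpoch_of_nat)
next
  case (nonpos m)
  have "qpoch x q r * qpoch y q r * (q / (x * y)) powi r / (qpoch (q / x) q r * qpoch (q / y) q r) =
      (qpoch x q r / qpoch (q / x) q r) * (qpoch y q r / qpoch (q / y) q r) * (q / (x * y)) powi r"
    by simp
  also have "\<dots> = (q / x\<^sup>2) ^ m * (q / y\<^sup>2) ^ m * (q / (x * y)) powi r *
      (qp x q m * qp y q m / (qp (q / x) q m * qp (q / y) q m))"
    unfolding nonpos qpoch_ratio_reflect[OF assms(1,3,6)] qpoch_ratio_reflect[OF assms(1,4,7)]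
    by simp
  also have "(q / x\<^sup>2) ^ m * (q / y\<^sup>2) ^ m * (q / (x * y)) powi r = (q / (x * y)) ^ m"
  proof -
    have "(q / x\<^sup>2) ^ m * (q / y\<^sup>2) ^ m * (q / (x * y)) powi r = (q / x\<^sup>2 * (q / y\<^sup>2) / (q / (x * y))) ^ m"
      unfolding nonpos power_int_minus by (simp add: power_mult_distrib power_divide divide_inverse power_inverse)
    also have "q / x\<^sup>2 * (q / y\<^sup>2) / (q / (x * y)) = q / (x * y)"
      using assms by (simp add: field_simps power2_eq_square)
    finally show ?thesis .
  qed
  finally have "qpoch x q r * qpoch y q r * (q / (x * y)) powi r / (qpoch (q / x) q r * qpoch (q / y) q r) =
      qp x q m * qp y q m * (q / (x * y)) ^ m / (qp (q / x) q m * qp (q / y) q m)"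
    by simp
  then show ?thesis
    using sum_gauss_weight_nonneg[OF assms, of m] by (simp add: nonpos mult_ac)
qed

lemma rq_bounded:
  assumes "q \<noteq> 0" "norm q < 1"
  obtains M where "M > 0" "\<And>m. norm (rq q m) \<le> M"
proof -
  obtain M where M: "M > 0" "\<And>n. norm (1 / qp q q n) \<le> M"
    using inverse_qp_bounded[OF assms(2) norm_q_power_mult_neq_1[OF assms(2,2)]] by blast
  have "norm (rq q m) \<le> M" for m
  proof (cases "m < 0")
    case True
    then show ?thesis
      using M(1) rq_neg[OF assms(1)] by simp
  next
    case False
    then show ?thesis
      using M(2)[of "nat m"] rq_of_nat[of q "nat m"] by simp
  qed
  then show ?thesis
    using that M(1) by blast
qed

subsection \<open>The Bailey pair\<close>

text \<open>The quadratic exponent makes the term ratio q^(n+1) z tend to 0. The negative half is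
  again of the positive form, with z replaced by 1/(zq).\<close>

lemma theta_summable:
  fixes q z :: complex
  assumes "q \<noteq> 0" "norm q < 1" "z \<noteq> 0"
  shows "(\<lambda>r. norm (q powi binom2 (r + 1) * z powi r)) summable_on (UNIV :: int set)"
proof -
  define g where "g = (\<lambda>z n. q powi binom2 (int n + 1) * z ^ n)"
  have g: "(\<lambda>n. norm (g z n)) summable_on (UNIV :: nat set)" if "z \<noteq> 0" for z
  proof -
    have "(\<lambda>n. q ^ n) \<longlonglongrightarrow> 0"
      using assms(2) by (rule LIMSEQ_power_zero)
    then have "(\<lambda>n. norm (q ^ Suc n * z)) \<longlonglongrightarrow> norm (0 * z)"
      by (intro tendsto_norm tendsto_mult tendsto_const) (rule LIMSEQ_Suc)
    then have "eventually (\<lambda>n. norm (q ^ Suc n * z) < 1 / 2) sequentially"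
      by (rule order_tendstoD) simp
    then obtain N where N: "\<And>n. n \<ge> N \<Longrightarrow> norm (q ^ Suc n * z) < 1 / 2"
      by (auto simp: eventually_sequentially)
    have "g z (Suc n) = g z n * (q ^ Suc n * z)" for n
      using assms(1) binom2_Suc[of "int n + 1"] by (simp add: g_def power_int_add add_ac)
    then have "norm (norm (g z (Suc n))) \<le> 1 / 2 * norm (norm (g z n))" if "n \<ge> N" for n
      using mult_left_mono[OF less_imp_le[OF N[OF that]], of "norm (g z n)"] by (simp add: norm_mult)
    then have "summable (\<lambda>n. norm (g z n))"
      by (intro summable_ratio_test[of "1 / 2" N]) auto
    then show ?thesis
      by (intro norm_summable_imp_summable_on) simp
  qed
  have "(\<lambda>r. norm (q powi binom2 (r + 1) * z powi r)) summable_on range int"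
    using g[OF assms(3)] by (subst summable_on_reindex) (auto simp: g_def o_def)
  moreover have "(\<lambda>r. norm (q powi binom2 (r + 1) * z powi r)) summable_on range (\<lambda>n. - int n)"
  proof -
    have "q powi binom2 (- int n + 1) * z powi (- int n) = g (1 / (z * q)) n" for n
    proof -
      have e: "binom2 (- int n + 1) = binom2 (int n + 1) - int n"
        using two_binom2[of "- int n + 1"] two_binom2[of "int n + 1"] by (simp add: algebra_simps)
      show ?thesis
        unfolding g_def e using assms by (simp add: power_int_diff power_int_minus field_simps)
    qed
    then show ?thesis
      using g[of "1 / (z * q)"] assms by (subst summable_on_reindex) (auto simp: o_def inj_on_def)
  qed
  moreover have "r \<in> range int \<union> range (\<lambda>n. - int n)" for r
    by (cases r rule: int_cases2) auto
  then have "range int \<union> range (\<lambda>n. - int n) = UNIV"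
    by blast
  ultimately show ?thesis
    using summable_on_union[of _ "range int" "range (\<lambda>n. - int n)"] by simp
qed

text \<open>Bounds the denominators 1 - q^(2r+1) and 1 - q^(2r-1) away from 0 uniformly in
  \<open>r\<close>; odd exponents are never 0.\<close>

lemma norm_one_minus_power_int:
  fixes q :: complex
  assumes "q \<noteq> 0" "norm q < 1" "k \<noteq> 0"
  shows "1 - norm q \<le> norm (1 - q powi k)"
proof (cases "k > 0")
  case True
  have "norm (q powi k) \<le> norm q powi 1"
    unfolding norm_power_int using True assms by (intro power_int_decreasing) auto
  then show ?thesis
    using norm_triangle_ineq2[of 1 "q powi k"] by simp
next
  case False
  have "norm q powi (- 1) \<le> norm q powi k"
    using False assms by (intro power_int_decreasing) auto
  moreover have "1 / norm q - 1 \<ge> 1 - norm q"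
  proof -
    have "(1 - norm q) * 1 \<le> (1 - norm q) * (1 / norm q)"
      using assms by (intro mult_left_mono) auto
    then show ?thesis using assms by (simp add: field_simps)
  qed
  ultimately show ?thesis
    using norm_triangle_ineq2[of "q powi k" 1]
    by (simp add: norm_power_int norm_minus_commute power_int_minus divide_inverse)
qed

text \<open>
  The sequence is not symmetrised: the usual \<open>\<alpha>\<^sub>n\<close> of a Bailey pair relative to \<open>1\<close> is
  \<open>alpha n + alpha (- n)\<close> for \<open>n > 0\<close>.
\<close>

definition alpha :: "complex \<Rightarrow> complex \<Rightarrow> complex \<Rightarrow> int \<Rightarrow> complex" where
  "alpha q b z r = q powi binom2 (r + 1) * z powi r *
     ((1 - b * q powi r) / (1 - q powi (2 * r + 1)) -
      (q powi r - b) / (z * q * (1 - q powi (2 * r - 1))))"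

text \<open>Once the denominators are bounded, only theta terms remain: a factor q^r is absorbed by
  replacing z with zq.\<close>

lemma alpha_summable:
  assumes "q \<noteq> 0" "norm q < 1" "z \<noteq> 0"
  shows "(\<lambda>r. norm (alpha q b z r)) summable_on UNIV"
proof (rule Infinite_Sum.abs_summable_on_comparison_test')
  define t where "t = (\<lambda>z r. norm (q powi binom2 (r + 1) * z powi r))"
  define B where "B = 1 / (1 - norm q)"
  show "(\<lambda>r. (t z r + norm b * t (z * q) r) * B +
      (t (z * q) r + norm b * t z r) * (B / norm (z * q))) summable_on UNIV"
    unfolding t_def using assms
    by (intro summable_on_add summable_on_cmult_left summable_on_cmult_right theta_summable) auto
  fix r :: int
  have q1: "1 - norm q > 0" using assms by simp
  have B: "norm (1 / (1 - q powi k)) \<le> B" if "k \<noteq> 0" for k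
    using norm_one_minus_power_int[OF assms(1,2) that] q1
    by (auto simp: B_def norm_divide intro!: divide_left_mono mult_pos_pos)
  define T where "T = q powi binom2 (r + 1) * z powi r"
  have t: "t z r = norm T" "t (z * q) r = norm (T * q powi r)"
    by (simp_all add: t_def T_def power_int_mult_distrib mult_ac)
  have "alpha q b z r = (T - b * (T * q powi r)) * (1 / (1 - q powi (2 * r + 1))) -
      (T * q powi r - b * T) * (1 / (1 - q powi (2 * r - 1)) / (z * q))"
    by (simp add: alpha_def T_def algebra_simps diff_divide_distrib)
  also have "norm \<dots> \<le> (norm T + norm b * norm (T * q powi r)) * B +
      (norm (T * q powi r) + norm b * norm T) * (B / norm (z * q))"
  proof (rule order_trans[OF norm_triangle_ineq4], rule add_mono)
    have "norm (T - b * (T * q powi r)) \<le> norm T + norm b * norm (T * q powi r)"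
      using norm_triangle_ineq4[of T "b * (T * q powi r)"] by (simp add: norm_mult)
    moreover have "norm (1 / (1 - q powi (2 * r + 1))) \<le> B"
      by (rule B) presburger
    ultimately show "norm ((T - b * (T * q powi r)) * (1 / (1 - q powi (2 * r + 1)))) \<le>
        (norm T + norm b * norm (T * q powi r)) * B"
      unfolding norm_mult[of "T - b * (T * q powi r)"] by (intro mult_mono) auto
    have "norm (T * q powi r - b * T) \<le> norm (T * q powi r) + norm b * norm T"
      using norm_triangle_ineq4[of "T * q powi r" "b * T"] by (simp add: norm_mult)
    moreover have "norm (1 / (1 - q powi (2 * r - 1)) / (z * q)) \<le> B / norm (z * q)"
      unfolding norm_divide[of _ "z * q"] by (intro divide_right_mono B norm_ge_zero) presburger
    ultimately show "norm ((T * q powi r - b * T) * (1 / (1 - q powi (2 * r - 1)) / (z * q))) \<le>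
        (norm (T * q powi r) + norm b * norm T) * (B / norm (z * q))"
      unfolding norm_mult[of "T * q powi r - b * T"] by (intro mult_mono) auto
  qed
  finally show "norm (alpha q b z r) \<le> (t z r + norm b * t (z * q) r) * B +
      (t (z * q) r + norm b * t z r) * (B / norm (z * q))"
    unfolding t .
qed

text \<open>Split the summand into \<open>A\<close> and \<open>B\<close> along the two fractions of
  \<open>alpha\<close>. Pairing \<open>A r\<close> with \<open>B (r + 1)\<close> instead of
  \<open>B r\<close> leaves the sum unchanged and makes both share the denominator 1 - q^(2r+1),
  which then cancels.\<close>

lemma bailey_pair:
  assumes "q \<noteq> 0" "norm q < 1" "z \<noteq> 0"
  shows "((\<lambda>r. alpha q b z r * rq q (int n - r) * rq q (int n + r)) has_sum
    (1 - b * q ^ n) * (qp (- 1 / z) q (n + 1) * qp (- z * q) q n / qp q q (2 * n + 1))) UNIV"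
proof -
  define th where "th = (\<lambda>r. q powi binom2 (r + 1) * z powi r)"
  define A where "A = (\<lambda>r. th r * ((1 - b * q powi r) / (1 - q powi (2 * r + 1))) * (rq q (int n - r) * rq q (int n + r)))"
  define B where "B = (\<lambda>r. - (th r * ((q powi r - b) / (z * q * (1 - q powi (2 * r - 1)))) * (rq q (int n - r) * rq q (int n + r))))"
  have zero: "rq q (int n - r) * rq q (int n + r) = 0" if "r \<notin> {- int n..int n}" for r
    using that rq_neg[OF assms(1), of "int n - r"] rq_neg[OF assms(1), of "int n + r"] by auto
  \<comment> \<open>Support in -n..n makes \<open>A\<close> and \<open>B\<close> summable
    separately, so they may be shifted against each other.\<close>
  have A: "(A has_sum sum A {- int n..int n}) UNIV"
    using zero by (intro has_sum_finite_neutralI[of "{- int n..int n}"]) (auto simp: A_def)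
  have B: "(B has_sum sum B {- int n..int n}) UNIV"
    using zero by (intro has_sum_finite_neutralI[of "{- int n..int n}"]) (auto simp: B_def)
  \<comment> \<open>With p = q^r the core is (1 - bp)(1 - q^(n+1) p) - p(pq - b)(1 - q^n/p) = (1 -
    p^2 q)(1 - b q^n).\<close>
  have "A r + B (r + 1) = (1 - b * q ^ n) * (th r * rq q (int n - r) * rq q (int n + r + 1))" for r
  proof -
    define u v p where "u = rq q (int n - r)" and "v = rq q (int n + r + 1)" and "p = q powi r"
    have p: "p \<noteq> 0" using assms by (simp add: p_def)
    have "q powi (2 * r + 1) \<noteq> 1"
    proof -
      have "2 * r + 1 \<noteq> 0" by presburger
      from norm_one_minus_power_int[OF assms(1,2) this] show ?thesis
        using assms(2) by auto
    qed
    moreover have pq: "q powi (2 * r + 1) = p * p * q"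
    proof -
      have "q powi (r + r + 1) = p * p * q"
        using power_int_add[of q "r + r" 1] power_int_add[of q r r] assms(1) by (simp add: p_def)
      then show ?thesis
        by (simp only: mult_2)
    qed
    ultimately have nz: "1 - p * p * q \<noteq> 0" by simp
    have "rq q (int n + r) = (1 - q ^ n * p * q) * v"
      using rq_rec[OF assms(1,2), of "int n + r + 1"] assms(1) by (simp add: v_def p_def power_int_add)
    then have A': "A r = th r * (1 - b * p) / (1 - p * p * q) * (1 - q ^ n * p * q) * u * v"
      by (simp add: A_def pq u_def p_def[symmetric])
    have "rq q (int n - (r + 1)) = (1 - q ^ n / p) * u"
      using rq_rec[OF assms(1,2), of "int n - r"] assms(1) by (simp add: u_def p_def power_int_diff algebra_simps)
    moreover have "th (r + 1) = th r * (p * q * z)"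
      using assms binom2_Suc[of "r + 1"] by (simp add: th_def p_def power_int_add)
    moreover have "2 * (r + 1) - 1 = 2 * r + 1" "int n + (r + 1) = int n + r + 1"
      by simp_all
    ultimately have B': "B (r + 1) = - (th r * (p * q * z) * ((p * q - b) / (z * q * (1 - p * p * q))) *
        ((1 - q ^ n / p) * u * v))"
      using assms(1) by (simp only: B_def pq v_def) (simp add: power_int_add p_def)
    show ?thesis
      unfolding A' B' u_def[symmetric] v_def[symmetric] using nz p assms(1,3)
      by (simp add: divide_simps) (simp add: algebra_simps)
  qed
  then have "((\<lambda>r. A r + B (r + 1)) has_sum
    (1 - b * q ^ n) * (qp (- 1 / z) q (n + 1) * qp (- z * q) q n / qp q q (2 * n + 1))) UNIV"
    using has_sum_cmult_right[OF finite_triple_product[OF assms, of n]] by (simp add: th_def)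
  moreover have "((\<lambda>r. A r + B (r + 1)) has_sum (sum A {- int n..int n} + sum B {- int n..int n})) UNIV"
    by (intro has_sum_add A has_sum_shift_int B)
  ultimately have "(1 - b * q ^ n) * (qp (- 1 / z) q (n + 1) * qp (- z * q) q n / qp q q (2 * n + 1)) =
      sum A {- int n..int n} + sum B {- int n..int n}"
    by (rule has_sum_unique)
  moreover have "((\<lambda>r. A r + B r) has_sum (sum A {- int n..int n} + sum B {- int n..int n})) UNIV"
    by (intro has_sum_add A B)
  moreover have "A r + B r = alpha q b z r * rq q (int n - r) * rq q (int n + r)" for r
    by (simp add: A_def B_def alpha_def th_def algebra_simps)
  ultimately show ?thesis
    by simp
qed

section \<open>Bailey's lemma: interchange of the two summations\<close>

theorem corollary4p1:
  fixes q b z x y :: complex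
  defines "L \<equiv> (\<lambda>n::nat.
      qpoch x q (int n) * qpoch y q (int n) * (1 - b * q ^ n) * (q / (x * y)) ^ n *
      (qpoch (- 1 / z) q (int n + 1) * qpoch (- z * q) q (int n) / qpoch q q (2 * int n + 1)))"
  defines "R \<equiv> (\<lambda>n::int.
      qpoch x q n * qpoch y q n * q powi binom2 (n + 1) * (q * z / (x * y)) powi n /
      (qpoch (q / x) q n * qpoch (q / y) q n) *
      ((1 - b * q powi n) / (1 - q powi (2 * n + 1)) -
       (q powi n - b) / (z * q * (1 - q powi (2 * n - 1)))))"
  assumes "0 < norm q" and "norm q < 1"
    and "z \<noteq> 0" and "x \<noteq> 0" and "y \<noteq> 0"
    and "norm (q / (x * y)) < 1"
    and "x \<notin> {q ^ m | m::nat. m \<ge> 1}" and "y \<notin> {q ^ m | m::nat. m \<ge> 1}"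
  shows "summable L \<and> R summable_on UNIV \<and>
    (\<Sum>n. L n) =
      qpoch_inf (q / x) q * qpoch_inf (q / y) q / (qpoch_inf q q * qpoch_inf (q / (x * y)) q) *
      (\<Sum>\<^sub>\<infinity>n\<in>UNIV. R n)"
proof -
  define K where "K = qpoch_inf (q / x) q * qpoch_inf (q / y) q / (qpoch_inf q q * qpoch_inf (q / (x * y)) q)"
  define \<rho> where "\<rho> = q / (x * y)"
  define X where "X = (\<lambda>n. qp x q n * qp y q n * \<rho> ^ n)"
  \<comment> \<open>Summing over \<open>r\<close> gives \<open>L n\<close> by the Bailey pair;
    summing over \<open>n\<close> gives \<open>K * R r\<close> by the q-Gauss sum.\<close>
  define T where "T = (\<lambda>(n, r). X n * alpha q b z r * rq q (int n - r) * rq q (int n + r))"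
  have q: "q \<noteq> 0" "norm q < 1" and \<rho>: "norm \<rho> < 1"
    using assms by (simp_all add: \<rho>_def)
  have nz: "q / x * q ^ j \<noteq> 1" "q / y * q ^ j \<noteq> 1" for j
  proof -
    have "x \<noteq> q ^ Suc j" "y \<noteq> q ^ Suc j"
      using assms(9,10) by (auto simp del: power_Suc)
    then show "q / x * q ^ j \<noteq> 1" "q / y * q ^ j \<noteq> 1"
      using assms(5,6,7) by (auto simp: field_simps)
  qed
  \<comment> \<open>Needed to pass from summability of \<open>K * R r\<close> to that of
    \<open>R\<close>.\<close>
  have K: "K \<noteq> 0"
    using qpoch_inf_nonzero[OF q(2) nz(1)] qpoch_inf_nonzero[OF q(2) nz(2)]
      qpoch_inf_nonzero[OF q(2) norm_q_power_mult_neq_1[OF q(2,2)]]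
      qpoch_inf_nonzero[OF q(2) norm_q_power_mult_neq_1[OF q(2) assms(8)]]
    by (simp add: K_def)

  have row: "((\<lambda>r. T (n, r)) has_sum L n) UNIV" for n
  proof -
    have "qpoch (- 1 / z) q (int n + 1) = qp (- 1 / z) q (n + 1)"
      "qpoch q q (2 * int n + 1) = qp q q (2 * n + 1)"
      using qpoch_of_nat[of "- 1 / z" q "n + 1"] qpoch_of_nat[of q q "2 * n + 1"]
      by (simp_all add: add.commute)
    then have "L n = X n * ((1 - b * q ^ n) * (qp (- 1 / z) q (n + 1) * qp (- z * q) q n / qp q q (2 * n + 1)))"
      unfolding L_def X_def \<rho>_def qpoch_of_nat by simp
    then show ?thesis
      using has_sum_cmult_right[OF bailey_pair[OF q assms(5), of b n], of "X n"]
      by (simp add: T_def mult.assoc)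
  qed
  have column: "((\<lambda>n. T (n, r)) has_sum K * R r) UNIV" for r
  proof -
    have "R r = alpha q b z r * (qpoch x q r * qpoch y q r * \<rho> powi r / (qpoch (q / x) q r * qpoch (q / y) q r))"
      by (simp add: R_def alpha_def \<rho>_def power_int_mult_distrib power_int_divide_distrib mult_ac)
    then show ?thesis
      using has_sum_cmult_right[OF sum_gauss_weight[OF q assms(6,7) \<rho>[unfolded \<rho>_def] nz], of "alpha q b z r" r]
      by (simp add: T_def X_def K_def \<rho>_def mult_ac)
  qed

  \<comment> \<open>The majorant separates into a geometric factor in \<open>n\<close> and the
    summable norm of \<open>alpha\<close> in \<open>r\<close>; all other factors are
    bounded.\<close>
  have "T summable_on UNIV \<times> UNIV"
  proof -
    obtain A where A: "A > 0" "\<And>n. norm (qp x q n) \<le> A" by (rule qp_bounded[OF q(2)]) blast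
    obtain B where B: "B > 0" "\<And>n. norm (qp y q n) \<le> B" by (rule qp_bounded[OF q(2)]) blast
    obtain E where E: "E > 0" "\<And>m. norm (rq q m) \<le> E" by (rule rq_bounded[OF q]) blast
    define g where "g = (\<lambda>(n, r). A * B * (E * E) * norm \<rho> ^ n * norm (alpha q b z r))"
    have "summable (\<lambda>n. norm \<rho> ^ n)"
      using \<rho> by (intro summable_geometric) simp
    then have "(\<lambda>n. norm \<rho> ^ n) summable_on UNIV"
      by (intro norm_summable_imp_summable_on) simp
    then have outer: "(\<lambda>n. A * B * (E * E) * norm \<rho> ^ n * (\<Sum>\<^sub>\<infinity>r. norm (alpha q b z r))) summable_on UNIV"
      by (intro summable_on_cmult_left summable_on_cmult_right)
    have inner: "((\<lambda>r. g (n, r)) has_sum A * B * (E * E) * norm \<rho> ^ n * (\<Sum>\<^sub>\<infinity>r. norm (alpha q b z r))) UNIV" for n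
      unfolding g_def prod.case
      by (intro has_sum_cmult_right has_sum_infsum alpha_summable q assms(5))
    have "g (n, r) \<ge> 0" for n r
      using A(1) B(1) E(1) by (simp add: g_def)
    then have "g summable_on UNIV \<times> UNIV"
      by (rule summable_on_SigmaI[OF inner outer])
    moreover have "norm (T p) \<le> g p" for p
    proof (cases p)
      case (Pair n r)
      have "norm (T (n, r)) = norm (qp x q n) * norm (qp y q n) *
          (norm (rq q (int n - r)) * norm (rq q (int n + r))) * norm \<rho> ^ n * norm (alpha q b z r)"
        by (simp add: T_def X_def norm_mult norm_power mult_ac)
      also have "\<dots> \<le> g (n, r)"
        unfolding g_def prod.case using A B E
        by (intro mult_mono mult_nonneg_nonneg) (auto intro: less_imp_le)
      finally show ?thesis
        using Pair by simp
    qed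
    ultimately show ?thesis
      by (rule abs_summable_summable[OF Infinite_Sum.abs_summable_on_comparison_test'])
  qed
  then obtain S where S: "(T has_sum S) (UNIV \<times> UNIV)"
    by (auto simp: summable_on_def)
  have "(L has_sum S) UNIV"
    using has_sum_SigmaD[OF S] row by simp
  then have L: "L sums S"
    by (rule has_sum_imp_sums)
  have "((\<lambda>(r, n). T (n, r)) has_sum S) (UNIV \<times> UNIV)"
    using S has_sum_swap by blast
  then have "((\<lambda>r. K * R r) has_sum S) UNIV"
    by (rule has_sum_SigmaD) (use column in simp)
  then have R: "(R has_sum S / K) UNIV"
    using has_sum_cmult_right_iff[OF K] by blast
  have "(\<Sum>\<^sub>\<infinity>n\<in>UNIV. R n) = S / K"
    using R by (rule infsumI)
  then show ?thesis
    using L R K unfolding K_def[symmetric] by (auto simp: sums_iff summable_on_def)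
qed

end
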